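(* Let $\mu_0$ be a commutative associative multiplication on a $\mathbb{K}$-vector space $A$, and let $\mu_t=\mu_0+t\varphi_1+t^2\varphi_2+\cdots$ be a $(Id+c+c^2)$-formal deformation of $\mu_0$. Let $\psi_1(x,y)=\varphi_1(x,y)-\varphi_1(y,x)$. Then $(A[[t]],\mu_t)$ is a deformation quantization of the $(Id+c+c^2)$-Poisson algebra $(A,\mu_0,\psi_1)$; that is, $(A,\mu_0,\psi_1)$ is a $(Id+c+c^2)$-Poisson algebra.
   Context: $\mathbb{K}$ is a field of characteristic $0$; multiplications are bilinear maps $A\times A\to A$. $\Sigma_3$ is the symmetric group, $c$ is the $3$-cycle with $c(1)=2,\ c(2)=3,\ c(3)=1$. For $v=\sum_\sigma a_\sigma\sigma\in\mathbb{K}[\Sigma_3]$ and a trilinear map $T$ on $A$, $(T\circ\Phi_v)(x_1,x_2,x_3)=\sum_\sigma a_\sigma T(x_{\sigma(1)},x_{\sigma(2)},x_{\sigma(3)})$. For bilinear maps $\varphi,\varphi'$ on $A$ put $(\varphi\bullet\varphi')(x,y,z)=\varphi(\varphi'(x,y),z)-\varphi(x,\varphi'(y,z))$. A $v$-formal deformation of $\mu_0$ is a family of bilinear maps $\varphi_j$ ($j\ge0$) on $A$ with $\varphi_0=\mu_0$, written $\mu_t=\sum_{j\ge 0} t^j\varphi_j$, such that $\sum_{i+j=k}(\varphi_i\bullet\varphi_j)\circ\Phi_v=0$ for all $k\ge0$. For bilinear maps $\mu,\psi$ let $\mathcal{L}(\mu,\psi)(x,y,z)=\psi(x,\mu(y,z))-\mu(y,\psi(x,z))-\mu(\psi(x,y),z)$.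 A $v$-Poisson algebra $(A,\mu,\psi)$ is a vector space $A$ with a commutative associative multiplication $\mu$ and a Lie bracket $\psi$ such that $\mathcal{L}(\mu,\psi)\circ\Phi_v=0$. *)

theory Defs
  imports Complex_Main "HOL-Combinatorics.Permutations" "HOL-Library.Function_Algebras"
begin

definition bilinear_map :: "('k::field \<Rightarrow> 'a::ab_group_add \<Rightarrow> 'a) \<Rightarrow> ('a \<Rightarrow> 'a \<Rightarrow> 'a) \<Rightarrow> bool" where
  "bilinear_map scale f \<longleftrightarrow>
     (\<forall>x. Vector_Spaces.linear scale scale (f x)) \<and>
     (\<forall>y. Vector_Spaces.linear scale scale (\<lambda>x. f x y))"

definition comm_assoc_mult :: "('k::field \<Rightarrow> 'a::ab_group_add \<Rightarrow> 'a) \<Rightarrow> ('a \<Rightarrow> 'a \<Rightarrow> 'a) \<Rightarrow> bool" where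
  "comm_assoc_mult scale \<mu> \<longleftrightarrow> bilinear_map scale \<mu> \<and>
     (\<forall>x y. \<mu> x y = \<mu> y x) \<and> (\<forall>x y z. \<mu> (\<mu> x y) z = \<mu> x (\<mu> y z))"

definition lie_bracket :: "('k::field \<Rightarrow> 'a::ab_group_add \<Rightarrow> 'a) \<Rightarrow> ('a \<Rightarrow> 'a \<Rightarrow> 'a) \<Rightarrow> bool" where
  "lie_bracket scale \<psi> \<longleftrightarrow> bilinear_map scale \<psi> \<and> (\<forall>x. \<psi> x x = 0) \<and>
     (\<forall>x y z. \<psi> x (\<psi> y z) + \<psi> y (\<psi> z x) + \<psi> z (\<psi> x y) = 0)"

text \<open>An element of the group algebra \<open>K[\<Sigma>\<^sub>3]\<close> is given by its coefficient function on the
  permutations of \<open>{1,2,3}\<close>; values at other functions on \<open>nat\<close> are never used.\<close>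

type_synonym 'k group_algebra3 = "(nat \<Rightarrow> nat) \<Rightarrow> 'k"

definition perm_elem :: "(nat \<Rightarrow> nat) \<Rightarrow> ('k::field) group_algebra3" where
  "perm_elem \<sigma> = (\<lambda>\<tau>. if \<tau> = \<sigma> then 1 else 0)"

definition cycle3 :: "nat \<Rightarrow> nat" where
  "cycle3 = id(1 := 2, 2 := 3, 3 := 1)"

text \<open>\<open>Id + c + c\<^sup>2\<close>, with pointwise addition of coefficient functions.\<close>

definition cyclic_elem :: "('k::field) group_algebra3" where
  "cyclic_elem = perm_elem id + perm_elem cycle3 + perm_elem (cycle3 \<circ> cycle3)"

text \<open>\<open>T \<circ> \<Phi>\<^sub>v\<close>.\<close>

definition comp_Phi :: "('k::field \<Rightarrow> 'a::ab_group_add \<Rightarrow> 'a) \<Rightarrow> 'k group_algebra3 \<Rightarrow>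
    ('a \<Rightarrow> 'a \<Rightarrow> 'a \<Rightarrow> 'a) \<Rightarrow> 'a \<Rightarrow> 'a \<Rightarrow> 'a \<Rightarrow> 'a" where
  "comp_Phi scale v T x1 x2 x3 =
     (let x = (\<lambda>i::nat. if i = 1 then x1 else if i = 2 then x2 else x3)
      in \<Sum>\<sigma> | \<sigma> permutes {1, 2, 3}. scale (v \<sigma>) (T (x (\<sigma> 1)) (x (\<sigma> 2)) (x (\<sigma> 3))))"

definition bullet :: "('a \<Rightarrow> 'a \<Rightarrow> 'a::ab_group_add) \<Rightarrow> ('a \<Rightarrow> 'a \<Rightarrow> 'a) \<Rightarrow> 'a \<Rightarrow> 'a \<Rightarrow> 'a \<Rightarrow> 'a" where
  "bullet \<phi> \<phi>' x y z = \<phi> (\<phi>' x y) z - \<phi> x (\<phi>' y z)"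

text \<open>The formal series \<open>\<mu>\<^sub>t = \<Sum>j. t\<^sup>j \<phi>\<^sub>j\<close> is represented by its sequence of coefficients \<open>\<phi>\<close>.\<close>

definition formal_deformation :: "('k::field \<Rightarrow> 'a::ab_group_add \<Rightarrow> 'a) \<Rightarrow> 'k group_algebra3 \<Rightarrow>
    ('a \<Rightarrow> 'a \<Rightarrow> 'a) \<Rightarrow> (nat \<Rightarrow> 'a \<Rightarrow> 'a \<Rightarrow> 'a) \<Rightarrow> bool" where
  "formal_deformation scale v \<mu>0 \<phi> \<longleftrightarrow>
     (\<forall>j. bilinear_map scale (\<phi> j)) \<and> \<phi> 0 = \<mu>0 \<and>
     (\<forall>k x y z. (\<Sum>i\<le>k. comp_Phi scale v (bullet (\<phi> i) (\<phi> (k - i))) x y z) = 0)"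

definition leibniz_defect :: "('a \<Rightarrow> 'a \<Rightarrow> 'a::ab_group_add) \<Rightarrow> ('a \<Rightarrow> 'a \<Rightarrow> 'a) \<Rightarrow> 'a \<Rightarrow> 'a \<Rightarrow> 'a \<Rightarrow> 'a" where
  "leibniz_defect \<mu> \<psi> x y z = \<psi> x (\<mu> y z) - \<mu> y (\<psi> x z) - \<mu> (\<psi> x y) z"

definition poisson_algebra :: "('k::field \<Rightarrow> 'a::ab_group_add \<Rightarrow> 'a) \<Rightarrow> 'k group_algebra3 \<Rightarrow>
    ('a \<Rightarrow> 'a \<Rightarrow> 'a) \<Rightarrow> ('a \<Rightarrow> 'a \<Rightarrow> 'a) \<Rightarrow> bool" where
  "poisson_algebra scale v \<mu> \<psi> \<longleftrightarrow> vector_space scale \<and>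
     comm_assoc_mult scale \<mu> \<and> lie_bracket scale \<psi> \<and>
     (\<forall>x y z. comp_Phi scale v (leibniz_defect \<mu> \<psi>) x y z = 0)"

end

theory Submission
  imports Defs
begin

text \<open>
  Write \<open>xy\<close> for \<open>\<mu>\<^sub>0(x,y)\<close> and \<open>\<psi>\<^sub>j(x,y) = \<phi>\<^sub>j(x,y) - \<phi>\<^sub>j(y,x)\<close>. After a cyclic shift of the second term,
  the cyclic sum of \<open>(\<phi>\<^sub>i \<bullet> \<phi>\<^sub>j)(x,y,z)\<close> is the cyclic sum of \<open>\<psi>\<^sub>i(\<phi>\<^sub>j(x,y),z)\<close>. This vanishes for
  \<open>i = 0\<close>, as \<open>\<mu>\<^sub>0\<close> is commutative. Order 1 of the deformation equation therefore says that the
  cyclic sum of \<open>\<psi>\<^sub>1(xy,z)\<close> is zero, and order 2 that the cyclic sum of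
  \<open>\<psi>\<^sub>2(xy,z) + \<psi>\<^sub>1(\<phi>\<^sub>1(x,y),z)\<close> is zero. The first is the Leibniz condition, since the two remaining
  terms of the Leibniz defect cancel in the cyclic sum. Exchanging \<open>x\<close> and \<open>y\<close> in the
  second and subtracting removes \<open>\<psi>\<^sub>2\<close> and leaves the Jacobi identity for \<open>\<psi>\<^sub>1\<close>.
\<close>

lemma cycle3_permutes: "cycle3 permutes {1, 2, 3}"
proof (rule bij_imp_permutes)
  show "bij_betw cycle3 {1, 2, 3} {1, 2, 3}"
    by (auto simp: bij_betw_def inj_on_def cycle3_def)
qed (auto simp: cycle3_def)

lemma sum_scale_perm_elem:
  fixes scale :: "'k::field \<Rightarrow> 'a::ab_group_add \<Rightarrow> 'a"
  assumes "vector_space scale" and "finite S" and "\<tau> \<in> S"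
  shows "(\<Sum>\<sigma>\<in>S. scale (perm_elem \<tau> \<sigma>) (f \<sigma>)) = f \<tau>"
proof -
  interpret vector_space scale by fact
  have "(\<Sum>\<sigma>\<in>S. scale (perm_elem \<tau> \<sigma>) (f \<sigma>)) = (\<Sum>\<sigma>\<in>S. if \<sigma> = \<tau> then f \<sigma> else 0)"
    by (intro sum.cong) (auto simp: perm_elem_def)
  with assms show ?thesis by simp
qed

text \<open>The coefficient function is a sum of three indicators, each picking out one permutation;
  \<open>cycle3 \<circ> cycle3\<close> sends 1, 2, 3 to 3, 1, 2.\<close>

lemma comp_Phi_cyclic_elem:
  fixes scale :: "'k::field \<Rightarrow> 'a::ab_group_add \<Rightarrow> 'a"
  assumes "vector_space scale"
  shows "comp_Phi scale cyclic_elem T x y z = T x y z + T y z x + T z x y"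
proof -
  interpret vector_space scale by fact
  have fin: "finite {\<sigma>. \<sigma> permutes {1, 2, 3::nat}}"
    by (simp add: finite_permutations)
  have perms: "id permutes {1, 2, 3::nat}" "cycle3 \<circ> cycle3 permutes {1, 2, 3}"
    by (simp_all only: permutes_id permutes_compose cycle3_permutes)
  show ?thesis
    unfolding comp_Phi_def cyclic_elem_def Let_def plus_fun_apply scale_left_distrib sum.distrib
    using perms cycle3_permutes
    by (simp only: sum_scale_perm_elem[OF assms fin] mem_Collect_eq)
      (simp add: cycle3_def)
qed

lemma bilinear_map_additive:
  assumes "bilinear_map scale f"
  shows "f (x + y) z = f x z + f y z" and "f z (x + y) = f z x + f z y"
    and "f (x - y) z = f x z - f y z" and "f z (x - y) = f z x - f z y"
proof -
  have l: "Vector_Spaces.linear scale scale (\<lambda>x. f x z)" and r: "Vector_Spaces.linear scale scale (f z)"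
    using assms by (auto simp: bilinear_map_def)
  from l have l': "module_hom scale scale (\<lambda>x. f x z)"
    by (simp add: Vector_Spaces.linear_def)
  from r have r': "module_hom scale scale (f z)"
    by (simp add: Vector_Spaces.linear_def)
  show "f (x + y) z = f x z + f y z" "f (x - y) z = f x z - f y z"
    using module_hom.add[OF l'] module_hom.diff[OF l'] by auto
  show "f z (x + y) = f z x + f z y" "f z (x - y) = f z x - f z y"
    using module_hom.add[OF r'] module_hom.diff[OF r'] by auto
qed

lemma bilinear_map_commutator:
  fixes scale :: "'k::field \<Rightarrow> 'a::ab_group_add \<Rightarrow> 'a"
  assumes "vector_space scale" and "bilinear_map scale f"
  shows "bilinear_map scale (\<lambda>x y. f x y - f y x)"
proof -
  interpret vector_space_pair scale scale
    using assms(1) by (simp add: vector_space_pair_def)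
  show ?thesis
    using assms(2) unfolding bilinear_map_def by (auto intro: linear_compose_sub)
qed

theorem corollary12:
  fixes scale :: "'k::field_char_0 \<Rightarrow> 'a::ab_group_add \<Rightarrow> 'a"
    and \<mu>0 :: "'a \<Rightarrow> 'a \<Rightarrow> 'a"
    and \<phi> :: "nat \<Rightarrow> 'a \<Rightarrow> 'a \<Rightarrow> 'a"
    and \<psi>1 :: "'a \<Rightarrow> 'a \<Rightarrow> 'a"
  assumes "vector_space scale"
    and "comm_assoc_mult scale \<mu>0"
    and "formal_deformation scale cyclic_elem \<mu>0 \<phi>"
    and "\<And>x y. \<psi>1 x y = \<phi> 1 x y - \<phi> 1 y x"
  shows "poisson_algebra scale cyclic_elem \<mu>0 \<psi>1"
proof -
  note cyc = comp_Phi_cyclic_elem[OF assms(1)]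
  from assms(3) have bil: "bilinear_map scale (\<phi> j)" and \<phi>0: "\<phi> 0 = \<mu>0"
    and eqn: "(\<Sum>i\<le>k. comp_Phi scale cyclic_elem (bullet (\<phi> i) (\<phi> (k - i))) x y z) = 0"
    for j k x y z
    by (auto simp: formal_deformation_def)
  have bil0: "bilinear_map scale \<mu>0" and comm: "\<mu>0 x y = \<mu>0 y x" for x y
    using assms(2) by (auto simp: comm_assoc_mult_def)
  have \<psi>1_eq: "\<psi>1 = (\<lambda>x y. \<phi> 1 x y - \<phi> 1 y x)"
    using assms(4) by (intro ext)
  have bil\<psi>: "bilinear_map scale \<psi>1"
    unfolding \<psi>1_eq by (rule bilinear_map_commutator[OF assms(1) bil])
  have anti: "\<psi>1 y x = - \<psi>1 x y" for x y
    by (simp add: assms(4))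
  define \<psi>2 where "\<psi>2 x y = \<phi> 2 x y - \<phi> 2 y x" for x y
  define P where "P x y z = \<psi>2 (\<mu>0 x y) z + \<psi>2 (\<mu>0 y z) x + \<psi>2 (\<mu>0 z x) y" for x y z

  have order1: "\<psi>1 (\<mu>0 x y) z + \<psi>1 (\<mu>0 y z) x + \<psi>1 (\<mu>0 z x) y = 0" for x y z
    \<comment> \<open>These instances of \<open>comm\<close> cancel the cyclic sum for
      \<open>i = 0\<close>, whose outer product is \<mu>0.\<close>
    using eqn[where k = 1 and x = x and y = y and z = z]
      comm[of "\<phi> 1 x y" z] comm[of "\<phi> 1 y z" x] comm[of "\<phi> 1 z x" y]
    by (simp add: cyc bullet_def \<phi>0 assms(4) algebra_simps)

  have order2: "P x y z + (\<psi>1 (\<phi> 1 x y) z + \<psi>1 (\<phi> 1 y z) x + \<psi>1 (\<phi> 1 z x) y) = 0" for x y z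
    using eqn[where k = 2 and x = x and y = y and z = z]
      comm[of "\<phi> 2 x y" z] comm[of "\<phi> 2 y z" x] comm[of "\<phi> 2 z x" y]
    by (simp add: cyc bullet_def \<phi>0 assms(4) \<psi>2_def P_def numeral_2_eq_2 algebra_simps)

  \<comment> \<open>As \<mu>0 is commutative, exchanging x and y fixes the first summand of
    \<open>P\<close> and swaps the other two.\<close>
  have "P y x z = P x y z" for x y z
    unfolding P_def comm[of y x] comm[of x z] comm[of z y] by (simp add: ac_simps)
  then have "\<psi>1 (\<phi> 1 x y) z + \<psi>1 (\<phi> 1 y z) x + \<psi>1 (\<phi> 1 z x) y
      = \<psi>1 (\<phi> 1 y x) z + \<psi>1 (\<phi> 1 x z) y + \<psi>1 (\<phi> 1 z y) x" for x y z
    using order2[of x y z] order2[of y x z] by (metis add_left_imp_eq)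
  \<comment> \<open>Additivity splits each summand into
    \<open>\<psi>1 (\<phi> 1 x y) z - \<psi>1 (\<phi> 1 y x) z\<close>, so the sum is the difference
    of the two sides just equated.\<close>
  then have jacobi': "\<psi>1 (\<psi>1 x y) z + \<psi>1 (\<psi>1 y z) x + \<psi>1 (\<psi>1 z x) y = 0" for x y z
    unfolding assms(4)[of x y] assms(4)[of y z] assms(4)[of z x] bilinear_map_additive[OF bil\<psi>]
    by (simp add: algebra_simps)
  have jacobi: "\<psi>1 x (\<psi>1 y z) + \<psi>1 y (\<psi>1 z x) + \<psi>1 z (\<psi>1 x y) = 0" for x y z
  proof -
    have "\<psi>1 x (\<psi>1 y z) + \<psi>1 y (\<psi>1 z x) + \<psi>1 z (\<psi>1 x y)
        = - (\<psi>1 (\<psi>1 x y) z + \<psi>1 (\<psi>1 y z) x + \<psi>1 (\<psi>1 z x) y)"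
      by (simp add: anti[of x "\<psi>1 y z"] anti[of y "\<psi>1 z x"] anti[of z "\<psi>1 x y"])
    then show ?thesis by (simp only: jacobi' minus_zero)
  qed

  have leibniz: "comp_Phi scale cyclic_elem (leibniz_defect \<mu>0 \<psi>1) x y z = 0" for x y z
  proof -
    have neg: "\<mu>0 (- a) b = - \<mu>0 a b" for a b
      \<comment> \<open>The second instance yields \<open>\<mu>0 0 b = 0\<close>.\<close>
      using bilinear_map_additive(3)[OF bil0, of 0 a b] bilinear_map_additive(3)[OF bil0, of 0 0 b]
      by simp
    \<comment> \<open>This turns the second term of the defect into the negative of a cyclic shift
      of its third.\<close>
    have swap: "\<mu>0 b (\<psi>1 a c) = - \<mu>0 (\<psi>1 c a) b" for a b c
      by (simp add: comm[of b] anti[of a c] neg)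
    have "comp_Phi scale cyclic_elem (leibniz_defect \<mu>0 \<psi>1) x y z
        = - (\<psi>1 (\<mu>0 x y) z + \<psi>1 (\<mu>0 y z) x + \<psi>1 (\<mu>0 z x) y)"
      by (simp add: cyc leibniz_defect_def swap anti[of "\<mu>0 x y" z] anti[of "\<mu>0 y z" x]
          anti[of "\<mu>0 z x" y])
    then show ?thesis by (simp add: order1)
  qed

  have "lie_bracket scale \<psi>1"
    unfolding lie_bracket_def using bil\<psi> jacobi by (simp add: assms(4))
  then show ?thesis
    unfolding poisson_algebra_def using assms(1,2) leibniz by simp
qed

end
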